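(* Let $\mathcal{G}$ be a finite, connected, simple graph with vertex set $\mathcal{V}$ and edge set $\mathcal{E}$, all of whose vertices have degree at least two, regarded as an equilateral quantum graph with every edge identified with $[0,1]$. Let $\Delta$ be the discrete Laplacian and $\mathcal{L}=-d^2/dx^2$ the Laplacian with Kirchhoff vertex conditions (both defined in the context). Let $\lambda > 0$ with $\lambda \notin \{ n^2\pi^2 \mid n = 0,1,2,\dots\}$, put $\omega = \sqrt{\lambda}$ and $\nu = 1-\cos(\sqrt{\lambda})$. Let $\phi_1,\phi_2:\mathcal{V}\to\mathbb{C}$ be eigenvectors of $\Delta$ with the same eigenvalue $\nu$. For $j=1,2$ let $y_j$ be an eigenfunction of $\mathcal{L}$ with eigenvalue $\lambda$ whose values at the vertices of $\mathcal{G}$ agree with those of $\phi_j$. For each edge $e$ and $j=1,2$, let $a_{e,j}$ and $b_{e,j}$ be the values of $\phi_j$ at the endpoints of $e$ identified with $0$ and $1$ respectively, and let $A_{e,j},B_{e,j}\in\mathbb{C}$ be the coefficients for which $y_j(x) = A_{e,j}\cos(\omega x) + B_{e,j}\sin(\omega x)$ on $e\cong[0,1]$. Then \[ \sum_{v\in\mathcal{V}} \deg(v)\,\phi_1(v)\overline{\phi_2(v)} = \sum_{e\in\mathcal{E}}\bigl(a_{e,1}\overline{a_{e,2}} + b_{e,1}\overline{b_{e,2}}\bigr) = \sum_{e\in\mathcal{E}}\bigl(A_{e,1}\overline{A_{e,2}} + B_{e,1}\overline{B_{e,2}}\bigr). \]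
   Context: Equilateral quantum graph: each edge of $\mathcal{G}$ is given an orientation and identified with the interval $[0,1]$, the endpoints $0,1$ corresponding to the two vertices of the edge. A function $f$ on $\mathcal{G}$ is a collection of components $f_e:[0,1]\to\mathbb{C}$, $e\in\mathcal{E}$. The Hilbert space is $L^2(\mathcal{G})=\bigoplus_{e\in\mathcal{E}}L^2[0,1]$ with inner product $\int_{\mathcal{G}} f\overline{g} = \sum_{e\in\mathcal{E}}\int_0^1 f_e(x)\overline{g_e(x)}\,dx$. The operator $\mathcal{L}$ acts by $\mathcal{L}f=-f''$ on each edge. Its domain consists of the functions that are sufficiently differentiable on each edge (components in the Sobolev space $H^2[0,1]$), continuous on $\mathcal{G}$ (edge components agree at common vertices), and satisfy at each vertex $v$ the Kirchhoff condition: the sum over the edges $e$ incident on $v$ of the derivatives of $f_e$ at $v$, taken with respect to local coordinates in which $v$ corresponds to $0$ (i.e. pointing from $v$ into the edge), is zero. $\mathcal{L}$ is self-adjoint on $L^2(\mathcal{G})$. The discrete Laplacian on functions $f:\mathcal{V}\to\mathbb{C}$ is $\Delta = I - T^{-1}A$, where $(Af)(v)=\sum_{w\sim v}f(w)$ is the adjacency operator and $(Tf)(v)=\deg(v)f(v)$ is the degree operator. *)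

theory Defs
  imports "HOL-Analysis.Analysis" "Graph_Theory.Graph_Theory"
begin

section \<open>Oriented simple graphs\<close>

text \<open>
  A finite simple graph is a \<^locale>\<open>pair_graph\<close>: every undirected edge is present as the two
  antiparallel arcs \<open>(u, v)\<close> and \<open>(v, u)\<close>, so \<open>out_degree\<close> is the usual degree.
  An orientation picks exactly one of the two. Its elements serve as the edge set:
  \<open>e = (u, v)\<close> is identified with \<open>[0,1]\<close> so that \<open>0\<close> is \<open>u\<close> and \<open>1\<close> is \<open>v\<close>.
\<close>

definition orientation :: "'v pair_pre_digraph \<Rightarrow> ('v \<times> 'v) set \<Rightarrow> bool" where
  "orientation G E \<longleftrightarrow>
     E \<subseteq> parcs G \<and> (\<forall>u v. (u, v) \<in> parcs G \<longrightarrow> ((u, v) \<in> E \<longleftrightarrow> (v, u) \<notin> E))"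

definition deg :: "'v pair_pre_digraph \<Rightarrow> 'v \<Rightarrow> nat" where
  "deg G v = out_degree (with_proj G) v"

definition incident_edges :: "('v \<times> 'v) set \<Rightarrow> 'v \<Rightarrow> ('v \<times> 'v) set" where
  "incident_edges E v = {e \<in> E. v = fst e \<or> v = snd e}"

section \<open>The discrete Laplacian\<close>

definition adjacency_op :: "'v pair_pre_digraph \<Rightarrow> ('v \<Rightarrow> complex) \<Rightarrow> 'v \<Rightarrow> complex" where
  "adjacency_op G f v = (\<Sum>w \<in> {w \<in> pverts G. v \<rightarrow>\<^bsub>with_proj G\<^esub> w}. f w)"

definition inv_degree_op :: "'v pair_pre_digraph \<Rightarrow> ('v \<Rightarrow> complex) \<Rightarrow> 'v \<Rightarrow> complex" where
  "inv_degree_op G f v = f v / of_nat (deg G v)"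

definition discrete_laplacian :: "'v pair_pre_digraph \<Rightarrow> ('v \<Rightarrow> complex) \<Rightarrow> 'v \<Rightarrow> complex" where
  "discrete_laplacian G f v = f v - inv_degree_op G (adjacency_op G f) v"

definition discrete_eigenvector ::
  "'v pair_pre_digraph \<Rightarrow> ('v \<Rightarrow> complex) \<Rightarrow> complex \<Rightarrow> bool" where
  "discrete_eigenvector G f \<nu> \<longleftrightarrow>
     (\<exists>v \<in> pverts G. f v \<noteq> 0) \<and> (\<forall>v \<in> pverts G. discrete_laplacian G f v = \<nu> * f v)"

section \<open>The Kirchhoff Laplacian\<close>

definition L2_edge :: "(real \<Rightarrow> complex) set" where
  "L2_edge = {g. g \<in> borel_measurable (lebesgue_on {0..1}) \<and>
                 integrable (lebesgue_on {0..1}) (\<lambda>x. (cmod (g x))\<^sup>2)}"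

definition edge_deriv :: "(real \<Rightarrow> complex) \<Rightarrow> real \<Rightarrow> complex" where
  "edge_deriv f x = vector_derivative f (at x within {0..1})"

text \<open>
  An element of \<open>H\<^sup>2[0,1]\<close> is given by its continuously differentiable representative:
  \<open>f'\<close> is absolutely continuous, i.e. the integral of some \<open>g\<close> in \<open>L\<^sup>2[0,1]\<close>, and this \<open>g\<close>
  (determined up to null sets) is \<open>f''\<close>.
\<close>

definition has_L2_second_deriv :: "(real \<Rightarrow> complex) \<Rightarrow> (real \<Rightarrow> complex) \<Rightarrow> bool" where
  "has_L2_second_deriv f g \<longleftrightarrow>
     f differentiable_on {0..1} \<and> g \<in> L2_edge \<and>
     (\<forall>x \<in> {0..1}. edge_deriv f x = edge_deriv f 0 + (\<integral>t. g t \<partial>lebesgue_on {0..x}))"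

definition H2_edge :: "(real \<Rightarrow> complex) set" where
  "H2_edge = {f. \<exists>g. has_L2_second_deriv f g}"

text \<open>
  A function on the quantum graph is a family \<open>f e\<close> of functions on \<open>[0,1]\<close>, with \<open>e\<close> ranging
  over the oriented edges. The next two definitions are meant for an endpoint \<open>v\<close> of \<open>e\<close>.
\<close>

definition vertex_value :: "('v \<times> 'v \<Rightarrow> real \<Rightarrow> complex) \<Rightarrow> 'v \<times> 'v \<Rightarrow> 'v \<Rightarrow> complex" where
  "vertex_value f e v = (if v = fst e then f e 0 else f e 1)"

text \<open>At the endpoint \<open>1\<close> the local coordinate is \<open>1 - x\<close>, whence the sign.\<close>

definition inward_deriv :: "('v \<times> 'v \<Rightarrow> real \<Rightarrow> complex) \<Rightarrow> 'v \<times> 'v \<Rightarrow> 'v \<Rightarrow> complex" where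
  "inward_deriv f e v = (if v = fst e then edge_deriv (f e) 0 else - edge_deriv (f e) 1)"

definition kirchhoff_domain ::
  "'v pair_pre_digraph \<Rightarrow> ('v \<times> 'v) set \<Rightarrow> ('v \<times> 'v \<Rightarrow> real \<Rightarrow> complex) set" where
  "kirchhoff_domain G E = {f.
     (\<forall>e \<in> E. f e \<in> H2_edge) \<and>
     (\<forall>v \<in> pverts G. \<forall>e \<in> incident_edges E v. \<forall>e' \<in> incident_edges E v.
        vertex_value f e v = vertex_value f e' v) \<and>
     (\<forall>v \<in> pverts G. (\<Sum>e \<in> incident_edges E v. inward_deriv f e v) = 0)}"

text \<open>
  The graph of the unbounded operator: \<open>f\<close> lies in the domain and \<open>h\<close> represents the
  element \<open>- f''\<close> of \<open>L\<^sup>2\<close>. The relation does not change when \<open>h\<close> is altered on null sets.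
\<close>

definition kirchhoff_laplacian ::
  "'v pair_pre_digraph \<Rightarrow> ('v \<times> 'v) set \<Rightarrow>
     ('v \<times> 'v \<Rightarrow> real \<Rightarrow> complex) \<Rightarrow> ('v \<times> 'v \<Rightarrow> real \<Rightarrow> complex) \<Rightarrow> bool" where
  "kirchhoff_laplacian G E f h \<longleftrightarrow>
     f \<in> kirchhoff_domain G E \<and> (\<forall>e \<in> E. has_L2_second_deriv (f e) (\<lambda>x. - h e x))"

definition kirchhoff_eigenfunction ::
  "'v pair_pre_digraph \<Rightarrow> ('v \<times> 'v) set \<Rightarrow> ('v \<times> 'v \<Rightarrow> real \<Rightarrow> complex) \<Rightarrow> complex \<Rightarrow> bool" where
  "kirchhoff_eigenfunction G E f \<mu> \<longleftrightarrow>
     \<not> (\<forall>e \<in> E. AE x in lebesgue_on {0..1}. f e x = 0) \<and>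
     kirchhoff_laplacian G E f (\<lambda>e x. \<mu> * f e x)"

end

theory Submission
  imports Defs
begin

text \<open>
  On an edge with endpoint values \<open>a\<close>, \<open>b\<close> one has \<open>A = a\<close> and \<open>b = A cos \<omega> + B sin \<omega>\<close>, so
  \<open>sin\<^sup>2 \<omega> (A\<^sub>1 A\<^sub>2\<^sup>* + B\<^sub>1 B\<^sub>2\<^sup>*) = a\<^sub>1 a\<^sub>2\<^sup>* + b\<^sub>1 b\<^sub>2\<^sup>* - cos \<omega> (a\<^sub>1 b\<^sub>2\<^sup>* + b\<^sub>1 a\<^sub>2\<^sup>*)\<close>.
  Summed over the edges, the mixed terms give the pairing of \<open>\<phi>\<^sub>1\<close> with the adjacency operator applied to
  \<open>\<phi>\<^sub>2\<close>, and the eigenvalue equation turns this into \<open>cos \<omega>\<close> times the weighted inner product \<open>S\<close>.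
  What remains is \<open>(1 - cos\<^sup>2 \<omega>) S\<close>, and \<open>sin \<omega> \<noteq> 0\<close>.
\<close>

text \<open>An orientation holds exactly one arc of each antiparallel pair, so the arcs split
  disjointly into \<open>E\<close> and its reversal.\<close>

lemma sum_parcs_eq_sum_orientation:
  fixes g :: "'v \<Rightarrow> 'v \<Rightarrow> complex"
  assumes "pair_graph G" and E: "orientation G E"
  shows "(\<Sum>(u, v) \<in> parcs G. g u v) = (\<Sum>(u, v) \<in> E. g u v + g v u)"
proof -
  interpret pair_graph G by fact
  have sub: "E \<subseteq> parcs G" using E by (simp add: orientation_def)
  have sym: "(v, u) \<in> parcs G" if "(u, v) \<in> parcs G" for u v
    using that by (rule arcs_symmetric)
  have fin: "finite E" using sub by (rule finite_subset) simp
  have eq: "parcs G = E \<union> prod.swap ` E"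
  proof (intro equalityI subsetI)
    fix e assume "e \<in> parcs G"
    then show "e \<in> E \<union> prod.swap ` E"
      using E by (cases e) (force simp: orientation_def)
  qed (use sub sym in auto)
  have "E \<inter> prod.swap ` E = {}"
    using E by (auto simp: orientation_def)
  then have "(\<Sum>(u, v) \<in> parcs G. g u v)
      = (\<Sum>(u, v) \<in> E. g u v) + (\<Sum>(u, v) \<in> prod.swap ` E. g u v)"
    unfolding eq using fin by (intro sum.union_disjoint) auto
  also have "(\<Sum>(u, v) \<in> prod.swap ` E. g u v) = (\<Sum>(u, v) \<in> E. g v u)"
    by (subst sum.reindex) (auto simp: case_prod_unfold)
  finally show ?thesis by (simp add: sum.distrib case_prod_unfold)
qed

text \<open>The arcs are fibred over their tails.\<close>

lemma sum_pverts_neighbours_eq_sum_parcs: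
  fixes g :: "'v \<Rightarrow> 'v \<Rightarrow> complex"
  assumes "pair_graph G"
  shows "(\<Sum>v \<in> pverts G. \<Sum>w \<in> {w \<in> pverts G. v \<rightarrow>\<^bsub>with_proj G\<^esub> w}. g v w)
    = (\<Sum>(v, w) \<in> parcs G. g v w)"
proof -
  interpret pair_graph G by fact
  have "Sigma (pverts G) (\<lambda>v. {w \<in> pverts G. v \<rightarrow>\<^bsub>with_proj G\<^esub> w}) = parcs G"
    by (auto dest: in_arcsD1 in_arcsD2)
  then show ?thesis by (simp add: sum.Sigma)
qed

lemma deg_eq_card_neighbours:
  assumes "pair_graph G"
  shows "deg G v = card {w \<in> pverts G. v \<rightarrow>\<^bsub>with_proj G\<^esub> w}"
proof -
  interpret pair_graph G by fact
  have "out_arcs (with_proj G) v = Pair v ` {w \<in> pverts G. v \<rightarrow>\<^bsub>with_proj G\<^esub> w}"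
    by (auto simp: out_arcs_def dest: in_arcsD2)
  then show ?thesis
    by (simp add: deg_def out_degree_def card_image inj_on_def)
qed

text \<open>Weighted handshake count: charge \<open>h\<close> to the tail of every arc. A vertex is
  the tail of \<open>deg G v\<close> arcs, and an edge gives one arc out of each end.\<close>

lemma sum_deg_eq_sum_orientation:
  fixes h :: "'v \<Rightarrow> complex"
  assumes "pair_graph G" and "orientation G E"
  shows "(\<Sum>v \<in> pverts G. of_nat (deg G v) * h v) = (\<Sum>(u, v) \<in> E. h u + h v)"
  using sum_pverts_neighbours_eq_sum_parcs[OF assms(1), of "\<lambda>v w. h v"]
    sum_parcs_eq_sum_orientation[OF assms, of "\<lambda>v w. h v"]
  by (simp add: deg_eq_card_neighbours[OF assms(1)])

text \<open>The same double count with a weight that sees both ends of an arc; the reversed arc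
  supplies the second mixed term.\<close>

lemma sum_adjacency_op_eq_sum_orientation:
  assumes "pair_graph G" and "orientation G E"
  shows "(\<Sum>v \<in> pverts G. f v * cnj (adjacency_op G h v))
    = (\<Sum>(u, v) \<in> E. f u * cnj (h v) + f v * cnj (h u))"
  using sum_pverts_neighbours_eq_sum_parcs[OF assms(1), of "\<lambda>v w. f v * cnj (h w)"]
    sum_parcs_eq_sum_orientation[OF assms, of "\<lambda>v w. f v * cnj (h w)"]
  by (simp add: adjacency_op_def sum_distrib_left)

lemma adjacency_op_discrete_eigenvector:
  assumes "discrete_eigenvector G f \<nu>" and "v \<in> pverts G" and "deg G v \<noteq> 0"
  shows "adjacency_op G f v = (1 - \<nu>) * of_nat (deg G v) * f v"
proof -
  have "f v - adjacency_op G f v / of_nat (deg G v) = \<nu> * f v"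
    using assms(1,2)
    by (simp add: discrete_eigenvector_def discrete_laplacian_def inv_degree_op_def)
  then show ?thesis using assms(3) by (simp add: field_simps)
qed

lemma sin_sqrt_neq_0:
  assumes "lam > 0" and "lam \<notin> {(real n)\<^sup>2 * pi\<^sup>2 | n :: nat. True}"
  shows "sin (sqrt lam) \<noteq> 0"
proof
  assume "sin (sqrt lam) = 0"
  then obtain i :: int where i: "sqrt lam = of_int i * pi"
    by (auto simp: sin_zero_iff_int2)
  have "lam = (sqrt lam)\<^sup>2" using assms(1) by simp
  \<comment> \<open>\<open>i\<close> may be negative, while the excluded values are indexed by
    naturals; squaring removes the sign.\<close>
  also have "\<dots> = (real (nat \<bar>i\<bar>))\<^sup>2 * pi\<^sup>2"
    by (simp add: i power_mult_distrib)
  finally show False using assms(2) by blast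
qed

text \<open>On expanding the right-hand side, the terms with \<open>c * s\<close> cancel,
  \<open>B\<^sub>1 * cnj B\<^sub>2\<close> has coefficient \<open>s\<^sup>2\<close>, and
  \<open>A\<^sub>1 * cnj A\<^sub>2\<close> has coefficient 1 + c^2 - 2 c^2, which is again
  \<open>s\<^sup>2\<close>.\<close>

lemma edge_coefficients_identity:
  fixes A\<^sub>1 A\<^sub>2 B\<^sub>1 B\<^sub>2 :: complex and c s :: real
  assumes "(complex_of_real s)\<^sup>2 = 1 - (complex_of_real c)\<^sup>2"
    and "b\<^sub>1 = A\<^sub>1 * c + B\<^sub>1 * s" and "b\<^sub>2 = A\<^sub>2 * c + B\<^sub>2 * s"
  shows "s\<^sup>2 * (A\<^sub>1 * cnj A\<^sub>2 + B\<^sub>1 * cnj B\<^sub>2)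
    = (A\<^sub>1 * cnj A\<^sub>2 + b\<^sub>1 * cnj b\<^sub>2) - c * (A\<^sub>1 * cnj b\<^sub>2 + b\<^sub>1 * cnj A\<^sub>2)"
  unfolding assms(2,3) using assms(1) by (simp add: algebra_simps) algebra

theorem theorem4p3:
  fixes G :: "'v pair_pre_digraph"
    and E :: "('v \<times> 'v) set"
    and lam \<omega> \<nu> :: real
    and \<phi> :: "nat \<Rightarrow> 'v \<Rightarrow> complex"
    and y :: "nat \<Rightarrow> 'v \<times> 'v \<Rightarrow> real \<Rightarrow> complex"
    and a b A B :: "'v \<times> 'v \<Rightarrow> nat \<Rightarrow> complex"
  assumes "pair_graph G"
    and "Digraph_Component.connected (with_proj G)"
    and "\<forall>v \<in> pverts G. deg G v \<ge> 2"
    and "orientation G E"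
    and "lam > 0"
    and "lam \<notin> {(real n)\<^sup>2 * pi\<^sup>2 | n :: nat. True}"
    and "\<omega> = sqrt lam"
    and "\<nu> = 1 - cos (sqrt lam)"
    and "\<forall>j \<in> {1, 2}. discrete_eigenvector G (\<phi> j) (complex_of_real \<nu>)"
    and "\<forall>j \<in> {1, 2}. kirchhoff_eigenfunction G E (y j) (complex_of_real lam)"
    and "\<forall>j \<in> {1, 2}. \<forall>v \<in> pverts G. \<forall>e \<in> incident_edges E v.
           vertex_value (y j) e v = \<phi> j v"
    and "\<forall>j \<in> {1, 2}. \<forall>e \<in> E. a e j = \<phi> j (fst e) \<and> b e j = \<phi> j (snd e)"
    and "\<forall>j \<in> {1, 2}. \<forall>e \<in> E. \<forall>x \<in> {0..1}.
           y j e x = A e j * complex_of_real (cos (\<omega> * x)) + B e j * complex_of_real (sin (\<omega> * x))"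
  shows "(\<Sum>v \<in> pverts G. of_nat (deg G v) * \<phi> 1 v * cnj (\<phi> 2 v))
           = (\<Sum>e \<in> E. a e 1 * cnj (a e 2) + b e 1 * cnj (b e 2))
       \<and> (\<Sum>e \<in> E. a e 1 * cnj (a e 2) + b e 1 * cnj (b e 2))
           = (\<Sum>e \<in> E. A e 1 * cnj (A e 2) + B e 1 * cnj (B e 2))"
proof -
  define c s where "c = cos \<omega>" and "s = sin \<omega>"
  define S where "S = (\<Sum>v \<in> pverts G. of_nat (deg G v) * \<phi> 1 v * cnj (\<phi> 2 v))"
  interpret pair_graph G by fact
  have s0: "s \<noteq> 0" using sin_sqrt_neq_0[OF assms(5,6)] assms(7) by (simp add: s_def)
  have cs: "(complex_of_real s)\<^sup>2 = 1 - (complex_of_real c)\<^sup>2"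
    by (simp add: c_def s_def sin_squared_eq flip: of_real_power)

  have ends: "a e j = A e j \<and> b e j = A e j * c + B e j * s"
    if "e \<in> E" "j \<in> {1, 2}" for e j
  proof -
    obtain u v where e: "e = (u, v)" by (cases e)
    have uv: "(u, v) \<in> parcs G" using that e assms(4) by (auto simp: orientation_def)
    then have "u \<in> pverts G" "v \<in> pverts G"
      using in_arcsD1 in_arcsD2 by blast+
    \<comment> \<open>A loop would have to lie both in \<open>E\<close> and outside it. Distinctness
      matters because \<open>vertex_value\<close> tests \<open>fst e\<close> first and returns the
      value at 1 only for a vertex other than \<open>u\<close>.\<close>
    moreover have "u \<noteq> v" using uv assms(4) by (auto simp: orientation_def)
    moreover have "e \<in> incident_edges E u" "e \<in> incident_edges E v"
      using that e by (auto simp: incident_edges_def)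
    ultimately have "y j e 0 = \<phi> j u" "y j e 1 = \<phi> j v"
      using assms(11) that by (force simp: vertex_value_def e)+
    moreover have "y j e 0 = A e j" "y j e 1 = A e j * c + B e j * s"
      using assms(13) that by (auto simp: c_def s_def)
    ultimately show ?thesis using assms(12) that by (auto simp: e)
  qed

  have S_edges: "S = (\<Sum>e \<in> E. a e 1 * cnj (a e 2) + b e 1 * cnj (b e 2))"
    using sum_deg_eq_sum_orientation[OF assms(1,4), of "\<lambda>v. \<phi> 1 v * cnj (\<phi> 2 v)"] assms(12)
    by (simp add: S_def mult.assoc case_prod_unfold)

  have "(\<Sum>e \<in> E. a e 1 * cnj (b e 2) + b e 1 * cnj (a e 2))
      = (\<Sum>v \<in> pverts G. \<phi> 1 v * cnj (adjacency_op G (\<phi> 2) v))"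
    using sum_adjacency_op_eq_sum_orientation[OF assms(1,4), of "\<phi> 1" "\<phi> 2"] assms(12)
    by (simp add: case_prod_unfold)
  also have "\<dots> = (\<Sum>v \<in> pverts G. c * (of_nat (deg G v) * \<phi> 1 v * cnj (\<phi> 2 v)))"
  proof (rule sum.cong)
    fix v assume v: "v \<in> pverts G"
    then have "deg G v \<noteq> 0" using assms(3) by fastforce
    \<comment> \<open>Here \<open>1 - \<nu>\<close> is \<open>c\<close>, which is real like the
      degree, so the conjugation in the pairing leaves both unchanged.\<close>
    with v have "adjacency_op G (\<phi> 2) v = c * of_nat (deg G v) * \<phi> 2 v"
      using adjacency_op_discrete_eigenvector[of G "\<phi> 2" "complex_of_real \<nu>" v] assms(7-9)
      by (simp add: c_def)
    then show "\<phi> 1 v * cnj (adjacency_op G (\<phi> 2) v)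
        = c * (of_nat (deg G v) * \<phi> 1 v * cnj (\<phi> 2 v))"
      by simp
  qed simp
  finally have mixed: "(\<Sum>e \<in> E. a e 1 * cnj (b e 2) + b e 1 * cnj (a e 2)) = c * S"
    by (simp add: S_def sum_distrib_left)

  have "s\<^sup>2 * (\<Sum>e \<in> E. A e 1 * cnj (A e 2) + B e 1 * cnj (B e 2))
      = (\<Sum>e \<in> E. (a e 1 * cnj (a e 2) + b e 1 * cnj (b e 2))
          - c * (a e 1 * cnj (b e 2) + b e 1 * cnj (a e 2)))"
    unfolding sum_distrib_left
  proof (rule sum.cong)
    fix e assume "e \<in> E"
    then show "s\<^sup>2 * (A e 1 * cnj (A e 2) + B e 1 * cnj (B e 2))
        = (a e 1 * cnj (a e 2) + b e 1 * cnj (b e 2))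
          - c * (a e 1 * cnj (b e 2) + b e 1 * cnj (a e 2))"
      using edge_coefficients_identity[OF cs, of "b e 1" "A e 1" "B e 1" "b e 2" "A e 2" "B e 2"]
        ends[of e 1] ends[of e 2] by simp
  qed simp
  also have "\<dots> = S - c * (c * S)"
    by (simp only: sum_subtractf mixed flip: S_edges sum_distrib_left)
  also have "\<dots> = s\<^sup>2 * S"
    unfolding of_real_power cs by (simp add: algebra_simps power2_eq_square)
  finally have "S = (\<Sum>e \<in> E. A e 1 * cnj (A e 2) + B e 1 * cnj (B e 2))"
    using s0 by simp
  with S_edges show ?thesis unfolding S_def by simp
qed

end
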